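(* Let $\mathcal{A}$ be the set of graph types consisting of the enhanced power graph, the commuting graph, the nilpotent graph, and the solvable graph. Then, for every graph type $\mathrm{A}\in\mathcal{A}$, the class of (uncompressed) conjugacy super$\mathrm{A}$ graphs of finite groups is universal, and the class of compressed conjugacy super$\mathrm{A}$ graphs of finite groups is universal.
   Context: All graphs are simple and undirected; adjacency is between distinct vertices. For a group $G$, each of the following graphs $\mathrm{A}(G)$ has vertex set $G$, with distinct $g,h\in G$ adjacent under the stated condition: enhanced power graph: both $g$ and $h$ are powers of some element $k\in G$; commuting graph: $gh=hg$; nilpotent graph: $\langle g,h\rangle$ is nilpotent; solvable graph: $\langle g,h\rangle$ is solvable. The (uncompressed) conjugacy super$\mathrm{A}$ graph of $G$ has vertex set $G$; distinct $g,h\in G$ are adjacent if and only if either $g$ and $h$ are conjugate in $G$, or there exist a conjugate $g'$ of $g$ and a conjugate $h'$ of $h$ such that $g'$ and $h'$ are adjacent in $\mathrm{A}(G)$. The compressed (condensed) conjugacy super$\mathrm{A}$ graph of $G$ has as vertices the conjugacy classes of $G$; two distinct classes $x^G$ and $y^G$ are adjacent if and only if there exist $x'\in x^G$ and $y'\in y^G$ adjacent in $\mathrm{A}(G)$. A class of finite graphs is called universal if every finite graph is isomorphic to an induced subgraph of some graph in the class. *)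

theory Defs
  imports "HOL-Algebra.Solvable_Groups" "HOL-Algebra.Group_Action" "Graph_Theory.Graph_Theory"
begin

section \<open>Nilpotent groups\<close>

definition commutator_subgroup :: "('a, 'b) monoid_scheme \<Rightarrow> 'a set \<Rightarrow> 'a set \<Rightarrow> 'a set" where
  "commutator_subgroup G H K =
     generate G (\<Union>h\<in>H. \<Union>k\<in>K. {h \<otimes>\<^bsub>G\<^esub> k \<otimes>\<^bsub>G\<^esub> inv\<^bsub>G\<^esub> h \<otimes>\<^bsub>G\<^esub> inv\<^bsub>G\<^esub> k})"

primrec lower_central_series :: "('a, 'b) monoid_scheme \<Rightarrow> nat \<Rightarrow> 'a set" where
  "lower_central_series G 0 = carrier G"
| "lower_central_series G (Suc n) = commutator_subgroup G (lower_central_series G n) (carrier G)"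

definition nilpotent_group :: "('a, 'b) monoid_scheme \<Rightarrow> bool" where
  "nilpotent_group G \<longleftrightarrow> (\<exists>n. lower_central_series G n = {\<one>\<^bsub>G\<^esub>})"


section \<open>Graphs on groups\<close>

text \<open>
  A finite simple undirected graph is a \<open>pair_graph\<close>: a finite, loop-free digraph without
  parallel arcs whose arc relation is symmetric.
\<close>

datatype graph_type = Enhanced_Power | Commuting | Nilpotent | Solvable

fun joined :: "graph_type \<Rightarrow> ('a, 'b) monoid_scheme \<Rightarrow> 'a \<Rightarrow> 'a \<Rightarrow> bool" where
  "joined Enhanced_Power G g h \<longleftrightarrow>
     (\<exists>k \<in> carrier G. (\<exists>m::int. g = k [^]\<^bsub>G\<^esub> m) \<and> (\<exists>n::int. h = k [^]\<^bsub>G\<^esub> n))"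
| "joined Commuting G g h \<longleftrightarrow> g \<otimes>\<^bsub>G\<^esub> h = h \<otimes>\<^bsub>G\<^esub> g"
| "joined Nilpotent G g h \<longleftrightarrow> nilpotent_group (G\<lparr>carrier := generate G {g, h}\<rparr>)"
| "joined Solvable G g h \<longleftrightarrow> solvable (G\<lparr>carrier := generate G {g, h}\<rparr>)"

definition group_graph :: "graph_type \<Rightarrow> ('a, 'b) monoid_scheme \<Rightarrow> 'a pair_pre_digraph" where
  "group_graph A G =
     \<lparr>pverts = carrier G,
      parcs = {(g, h). g \<in> carrier G \<and> h \<in> carrier G \<and> g \<noteq> h \<and> joined A G g h}\<rparr>"

definition conjugation :: "('a, 'b) monoid_scheme \<Rightarrow> 'a \<Rightarrow> 'a \<Rightarrow> 'a" where
  "conjugation G = (\<lambda>g. \<lambda>x \<in> carrier G. g \<otimes>\<^bsub>G\<^esub> x \<otimes>\<^bsub>G\<^esub> inv\<^bsub>G\<^esub> g)"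

abbreviation conj_class :: "('a, 'b) monoid_scheme \<Rightarrow> 'a \<Rightarrow> 'a set" where
  "conj_class G \<equiv> Group_Action.orbit G (conjugation G)"

abbreviation conj_classes :: "('a, 'b) monoid_scheme \<Rightarrow> 'a set set" where
  "conj_classes G \<equiv> orbits G (carrier G) (conjugation G)"

definition conj_super_graph :: "graph_type \<Rightarrow> ('a, 'b) monoid_scheme \<Rightarrow> 'a pair_pre_digraph" where
  "conj_super_graph A G =
     \<lparr>pverts = carrier G,
      parcs = {(g, h). g \<in> carrier G \<and> h \<in> carrier G \<and> g \<noteq> h \<and>
        (h \<in> conj_class G g \<or>
         (\<exists>g' \<in> conj_class G g. \<exists>h' \<in> conj_class G h. (g', h') \<in> parcs (group_graph A G)))}\<rparr>"

definition compressed_conj_super_graph ::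
    "graph_type \<Rightarrow> ('a, 'b) monoid_scheme \<Rightarrow> 'a set pair_pre_digraph" where
  "compressed_conj_super_graph A G =
     \<lparr>pverts = conj_classes G,
      parcs = {(X, Y). X \<in> conj_classes G \<and> Y \<in> conj_classes G \<and> X \<noteq> Y \<and>
        (\<exists>x' \<in> X. \<exists>y' \<in> Y. (x', y') \<in> parcs (group_graph A G))}\<rparr>"


section \<open>Universality\<close>

text \<open>
  The type argument is the type from which the vertices of the embedded finite graphs are drawn;
  it cannot be quantified inside the definition, so theorems leave it as a free type variable.
\<close>

definition universal :: "'v itself \<Rightarrow> 'a pair_pre_digraph set \<Rightarrow> bool" where
  "universal _ \<C> \<longleftrightarrow>
     (\<forall>\<Delta> \<in> \<C>. pair_graph \<Delta>) \<and>
     (\<forall>\<Gamma> :: 'v pair_pre_digraph. pair_graph \<Gamma> \<longrightarrow>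
        (\<exists>\<Delta> \<in> \<C>. \<exists>S :: 'a pair_pre_digraph.
           induced_subgraph (with_proj S) (with_proj \<Delta>) \<and>
           digraph_iso (with_proj \<Gamma>) (with_proj S)))"

text \<open>
  Every finite group is isomorphic to one whose carrier is a set of natural numbers, so these
  represent all finite groups up to isomorphism.
\<close>

definition finite_groups :: "nat monoid set" where
  "finite_groups = {G. group G \<and> finite (carrier G)}"


section \<open>The graphs are finite simple graphs\<close>

lemma joined_sym: "joined A G g h \<Longrightarrow> joined A G h g"
  by (cases A) (auto simp: insert_commute)

lemma group_graph_sym:
  "(g, h) \<in> parcs (group_graph A G) \<Longrightarrow> (h, g) \<in> parcs (group_graph A G)"
  by (auto simp: group_graph_def intro: joined_sym)

lemma group_action_conjugation:
  assumes "group G"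
  shows "group_action G (carrier G) (conjugation G)"
  using group.action_by_conjugation[OF assms] unfolding conjugation_def .

lemma pair_graphI:
  assumes "finite (pverts D)"
    and "\<And>u v. (u, v) \<in> parcs D \<Longrightarrow> u \<in> pverts D \<and> v \<in> pverts D \<and> u \<noteq> v \<and> (v, u) \<in> parcs D"
  shows "pair_graph D"
proof -
  have "parcs D \<subseteq> pverts D \<times> pverts D" using assms(2) by auto
  then have "finite (parcs D)" using assms(1) by (meson finite_SigmaI finite_subset)
  moreover have "symmetric (with_proj D)"
    using assms(2) by (auto simp: symmetric_def intro!: symI)
  ultimately show ?thesis using assms by unfold_locales auto
qed

lemma pair_graph_group_graph:
  assumes "finite (carrier G)"
  shows "pair_graph (group_graph A G)"
  using assms by (intro pair_graphI) (auto simp: group_graph_def intro: joined_sym)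

lemma pair_graph_conj_super_graph:
  assumes "group G" "finite (carrier G)"
  shows "pair_graph (conj_super_graph A G)"
proof (rule pair_graphI)
  show "finite (pverts (conj_super_graph A G))"
    using assms by (simp add: conj_super_graph_def)
  fix u v assume "(u, v) \<in> parcs (conj_super_graph A G)"
  then show "u \<in> pverts (conj_super_graph A G) \<and> v \<in> pverts (conj_super_graph A G) \<and> u \<noteq> v \<and>
      (v, u) \<in> parcs (conj_super_graph A G)"
    using group_action.orbit_sym[OF group_action_conjugation[OF assms(1)]] group_graph_sym[of _ _ A G]
    by (fastforce simp: conj_super_graph_def)
qed

lemma pair_graph_compressed_conj_super_graph:
  assumes "finite (carrier G)"
  shows "pair_graph (compressed_conj_super_graph A G)"
proof (rule pair_graphI)
  have "conj_classes G = conj_class G ` carrier G" by (auto simp: orbits_def)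
  then show "finite (pverts (compressed_conj_super_graph A G))"
    using assms by (simp add: compressed_conj_super_graph_def)
qed (auto simp: compressed_conj_super_graph_def dest: group_graph_sym)

end

theory Submission
  imports Defs "HOL-Algebra.Product_Groups" "HOL-Computational_Algebra.Primes"
begin

text \<open>
  In all four types, a join in the enhanced power graph implies a join in \<open>A(G)\<close>, which in turn
  implies a join in the solvable graph. Hence one group serves all of them, provided that adjacent
  vertices are sent to elements of a common cyclic subgroup and non-adjacent ones to elements no
  conjugates of which generate a solvable subgroup.

  Give the vertices distinct odd primes \<open>p\<^sub>v\<close>, and let \<open>G\<close> be the product of the symmetric groups
  of degree \<open>max p\<^sub>u p\<^sub>v\<close> over all pairs \<open>(u, v)\<close> of vertices that are not adjacent. Send \<open>v\<close> to the
  element that is a \<open>p\<^sub>v\<close>-cycle in the factors belonging to \<open>v\<close> and trivial in the others. Adjacent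
  vertices yield elements with disjoint supports and coprime orders, so both are powers of their
  product. For a non-adjacent pair with \<open>p\<^sub>u < p\<^sub>v\<close>, conjugates of the two elements generate in the
  factor \<open>(u, v)\<close> a transitive group of prime degree \<open>p\<^sub>v\<close> in which a nontrivial element fixes
  \<open>p\<^sub>v - p\<^sub>u \<ge> 2\<close> points; by a theorem of Galois it is not solvable. The pairs \<open>(u, u)\<close> are included
  to keep the conjugacy classes of the chosen elements distinct.
\<close>

section \<open>Transitive groups of prime degree\<close>

text \<open>The bijections carry the class of \<open>x\<close> onto the class of \<open>y\<close>,
  so all classes have the same size and this size divides a prime. The class of \<open>a\<close>
  also contains \<open>b\<close>, so it has more than one element and must be all of
  \<open>E\<close>.\<close>

lemma invariant_equiv_prime_card:
  assumes "equiv E R" "prime (card E)"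
    and "a \<in> E" "b \<in> E" "a \<noteq> b" "(a, b) \<in> R"
    and inv: "\<And>x y. x \<in> E \<Longrightarrow> y \<in> E \<Longrightarrow>
      \<exists>f. bij_betw f E E \<and> f x = y \<and> (\<forall>u\<in>E. \<forall>v\<in>E. (f u, f v) \<in> R \<longleftrightarrow> (u, v) \<in> R)"
  shows "R = E \<times> E"
proof -
  have fin: "finite E"
    using assms(2) by (metis card.infinite not_prime_0)
  have R: "R \<subseteq> E \<times> E"
    using assms(1) by (auto dest: equiv_type)
  have eqc: "card (R `` {x}) = card (R `` {y})" if xy: "x \<in> E" "y \<in> E" for x y
  proof -
    obtain f where f: "bij_betw f E E" "f x = y" "\<forall>u\<in>E. \<forall>v\<in>E. (f u, f v) \<in> R \<longleftrightarrow> (u, v) \<in> R"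
      using inv xy by metis
    have "f ` (R `` {x}) = R `` {y}"
    proof
      show "f ` (R `` {x}) \<subseteq> R `` {y}"
        using f xy R by auto
      show "R `` {y} \<subseteq> f ` (R `` {x})"
      proof
        fix z assume z: "z \<in> R `` {y}"
        then have "z \<in> E" using R by auto
        then obtain w where "w \<in> E" "f w = z"
          using f(1) unfolding bij_betw_def by (metis imageE)
        then show "z \<in> f ` (R `` {x})" using f xy z by auto
      qed
    qed
    moreover have "inj_on f (R `` {x})"
      using f(1) R by (auto simp: bij_betw_def intro: inj_on_subset)
    ultimately show ?thesis using card_image by metis
  qed
  have "card (R `` {a}) * card (E // R) = card (\<Union>(E // R))"
  proof (rule card_partition)
    show "finite (E // R)" using fin R by (simp add: finite_quotient)
    show "finite (\<Union>(E // R))" using fin assms(1) by (simp add: Union_quotient)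
    show "card c = card (R `` {a})" if "c \<in> E // R" for c
      using that eqc[OF _ assms(3)] by (metis quotientE)
    show "c \<inter> d = {}" if "c \<in> E // R" "d \<in> E // R" "c \<noteq> d" for c d
      using that quotient_disj[OF assms(1)] by blast
  qed
  then have "card (R `` {a}) dvd card E"
    using assms(1) by (metis Union_quotient dvd_triv_left)
  moreover have "card (R `` {a}) \<noteq> 1"
  proof
    assume "card (R `` {a}) = 1"
    then obtain z where "R `` {a} = {z}" by (auto simp: card_1_singleton_iff)
    moreover have "a \<in> R `` {a}" "b \<in> R `` {a}"
      using assms(3,6) equiv_class_self[OF assms(1)] by simp_all
    ultimately show False using assms(5) by auto
  qed
  ultimately have "card (R `` {a}) = card E"
    using assms(2) by (auto simp: prime_nat_iff)
  then have "R `` {x} = E" if "x \<in> E" for x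
    using eqc[OF that assms(3)] fin R by (intro card_subset_eq) auto
  then show ?thesis using R by auto
qed

section \<open>Orbits of subgroups in an action of prime degree\<close>

lemma (in group_action) group_G: "group G"
  using group_hom by (rule group_hom.axioms)

lemma (in group_action) bij_betw_action: "g \<in> carrier G \<Longrightarrow> bij_betw (\<phi> g) E E"
  using bij_prop0 by (simp add: Bij_def)

lemma (in group_action) one_action: "x \<in> E \<Longrightarrow> \<phi> \<one> x = x"
  using id_eq_one by (metis restrict_apply')

lemma (in group_action) inv_action: "g \<in> carrier G \<Longrightarrow> x \<in> E \<Longrightarrow> \<phi> (inv g) (\<phi> g x) = x"
  using orbit_sym_aux by blast

lemma (in group_action) action_inv: "g \<in> carrier G \<Longrightarrow> x \<in> E \<Longrightarrow> \<phi> g (\<phi> (inv g) x) = x"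
  using inv_action[of "inv g"] group.inv_closed[OF group_G] group.inv_inv[OF group_G] by simp

lemma (in group_action) closed_action: "g \<in> carrier G \<Longrightarrow> x \<in> E \<Longrightarrow> \<phi> g x \<in> E"
  using element_image by blast

lemma (in group_action) equiv_orbit_subgroup:
  assumes "subgroup M G"
  shows "equiv E {(x, y). x \<in> E \<and> (\<exists>m\<in>M. \<phi> m x = y)}" (is "equiv E ?R")
proof (rule equivI)
  interpret M: subgroup M G by fact
  show "?R \<subseteq> E \<times> E"
    using closed_action M.subset by auto
  show "refl_on E ?R"
    using one_action M.one_closed by (fastforce simp: refl_on_def)
  show "sym ?R"
  proof (rule symI, clarsimp)
    fix x m assume "x \<in> E" "m \<in> M"
    then show "\<phi> m x \<in> E \<and> (\<exists>n\<in>M. \<phi> n (\<phi> m x) = x)"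
      by (intro conjI bexI[of _ "inv m"]) (simp_all add: inv_action closed_action)
  qed
  show "trans ?R"
  proof (rule transI, clarsimp)
    fix x m n assume "x \<in> E" "m \<in> M" "n \<in> M"
    then show "\<exists>k\<in>M. \<phi> k x = \<phi> n (\<phi> m x)"
      by (intro bexI[of _ "n \<otimes> m"]) (simp_all add: composition_rule)
  qed
qed

text \<open>The orbits of \<open>M\<close> are the classes of an equivalence relation, and the orbit
  of \<open>z\<close> is nontrivial. The two conditions on \<open>g\<close> give the two directions
  of invariance. They are stated pointwise on \<open>E\<close>, so they cover elements that
  normalise \<open>M\<close> as well as elements that merely act as permutations commuting with
  it.\<close>

lemma (in group_action) transitive_subgroup_prime_degree:
  assumes "subgroup M G" "prime (card E)"
    and "m \<in> M" "z \<in> E" "\<phi> m z \<noteq> z"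
    and inv: "\<And>x y. x \<in> E \<Longrightarrow> y \<in> E \<Longrightarrow> \<exists>g\<in>carrier G. \<phi> g x = y \<and>
        (\<forall>n\<in>M. \<exists>n'\<in>M. \<forall>w\<in>E. \<phi> g (\<phi> n w) = \<phi> n' (\<phi> g w)) \<and>
        (\<forall>n\<in>M. \<exists>n'\<in>M. \<forall>w\<in>E. \<phi> g (\<phi> n' w) = \<phi> n (\<phi> g w))"
    and "x \<in> E" "y \<in> E"
  shows "\<exists>n\<in>M. \<phi> n x = y"
proof -
  interpret M: subgroup M G by fact
  let ?R = "{(x, y). x \<in> E \<and> (\<exists>m\<in>M. \<phi> m x = y)}"
  have "E \<times> E = ?R"
  proof (rule invariant_equiv_prime_card[OF equiv_orbit_subgroup[OF assms(1)] assms(2), symmetric])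
    show "z \<in> E" "\<phi> m z \<in> E" "z \<noteq> \<phi> m z" "(z, \<phi> m z) \<in> ?R"
      using assms closed_action by auto
    fix x y assume "x \<in> E" "y \<in> E"
    then obtain g where g: "g \<in> carrier G" "\<phi> g x = y"
        "\<forall>n\<in>M. \<exists>n'\<in>M. \<forall>w\<in>E. \<phi> g (\<phi> n w) = \<phi> n' (\<phi> g w)"
        "\<forall>n\<in>M. \<exists>n'\<in>M. \<forall>w\<in>E. \<phi> g (\<phi> n' w) = \<phi> n (\<phi> g w)"
      using inv by metis
    have "(\<phi> g u, \<phi> g v) \<in> ?R \<longleftrightarrow> (u, v) \<in> ?R" if uv: "u \<in> E" "v \<in> E" for u v
    proof
      assume "(u, v) \<in> ?R"
      then obtain n where "n \<in> M" "\<phi> n u = v" by auto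
      then show "(\<phi> g u, \<phi> g v) \<in> ?R"
        using g(1,3) uv closed_action by fastforce
    next
      assume "(\<phi> g u, \<phi> g v) \<in> ?R"
      then obtain n where n: "n \<in> M" "\<phi> n (\<phi> g u) = \<phi> g v" by auto
      then obtain n' where n': "n' \<in> M" "\<phi> g (\<phi> n' u) = \<phi> g v"
        using g(4) uv by metis
      then have "\<phi> n' u = v"
        using inj_prop[OF g(1)] closed_action uv M.mem_carrier by (meson inj_onD)
      then show "(u, v) \<in> ?R" using n' uv by auto
    qed
    then show "\<exists>f. bij_betw f E E \<and> f x = y \<and> (\<forall>u\<in>E. \<forall>v\<in>E. (f u, f v) \<in> ?R \<longleftrightarrow> (u, v) \<in> ?R)"
      using g(1,2) bij_betw_action by (intro exI[of _ "\<phi> g"] conjI ballI) auto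
  qed
  moreover have "(x, y) \<in> E \<times> E" using assms(7,8) by simp
  ultimately have "(x, y) \<in> ?R" by (rule subst)
  then show ?thesis by simp
qed

text \<open>Transitivity supplies the \<open>g\<close>, and normality makes it permute the orbits of
  \<open>M\<close>: the witnesses \<open>n'\<close> are the conjugates of \<open>n\<close> by
  \<open>g\<close> and by \<open>inv g\<close>.\<close>

lemma (in transitive_action) normal_subgroup_transitive:
  assumes "M \<lhd> G" "prime (card E)"
    and "m \<in> M" "z \<in> E" "\<phi> m z \<noteq> z" "x \<in> E" "y \<in> E"
  shows "\<exists>n\<in>M. \<phi> n x = y"
proof (rule transitive_subgroup_prime_degree[OF _ assms(2-5) _ assms(6,7)])
  interpret group G by (rule group_G)
  interpret M: normal M G by fact
  show "subgroup M G" ..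
  fix x y assume "x \<in> E" "y \<in> E"
  then obtain g where g: "g \<in> carrier G" "\<phi> g x = y" using unique_orbit by blast
  moreover have "\<exists>n'\<in>M. \<forall>w\<in>E. \<phi> g (\<phi> n w) = \<phi> n' (\<phi> g w)" if "n \<in> M" for n
  proof (intro bexI ballI)
    show "g \<otimes> n \<otimes> inv g \<in> M" using that g M.inv_op_closed2 by blast
    fix w assume "w \<in> E"
    then show "\<phi> g (\<phi> n w) = \<phi> (g \<otimes> n \<otimes> inv g) (\<phi> g w)"
      using that g closed_action inv_action composition_rule M.mem_carrier by simp
  qed
  moreover have "\<exists>n'\<in>M. \<forall>w\<in>E. \<phi> g (\<phi> n' w) = \<phi> n (\<phi> g w)" if "n \<in> M" for n
  proof (intro bexI ballI)
    show "inv g \<otimes> n \<otimes> g \<in> M" using that g M.inv_op_closed1 by blast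
    fix w assume "w \<in> E"
    then show "\<phi> g (\<phi> (inv g \<otimes> n \<otimes> g) w) = \<phi> n (\<phi> g w)"
      using that g closed_action action_inv composition_rule M.mem_carrier by simp
  qed
  ultimately show "\<exists>g\<in>carrier G. \<phi> g x = y \<and>
        (\<forall>n\<in>M. \<exists>n'\<in>M. \<forall>w\<in>E. \<phi> g (\<phi> n w) = \<phi> n' (\<phi> g w)) \<and>
        (\<forall>n\<in>M. \<exists>n'\<in>M. \<forall>w\<in>E. \<phi> g (\<phi> n' w) = \<phi> n (\<phi> g w))" by blast
qed

lemma (in transitive_action) abelian_normal_imp_fixed_point_free:
  assumes "M \<lhd> G" "prime (card E)"
    and "m \<in> M" "z \<in> E" "\<phi> m z \<noteq> z"
    and comm: "\<And>m n x. m \<in> M \<Longrightarrow> n \<in> M \<Longrightarrow> x \<in> E \<Longrightarrow> \<phi> m (\<phi> n x) = \<phi> n (\<phi> m x)"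
    and "c \<in> carrier G" "a \<in> E" "b \<in> E" "a \<noteq> b" "\<phi> c a = a" "\<phi> c b = b" "x \<in> E"
  shows "\<phi> c x = x"
proof -
  interpret group G by (rule group_G)
  interpret M: normal M G by fact
  note trans = normal_subgroup_transitive[OF assms(1-5)]
  note rules = closed_action composition_rule inv_action action_inv M.mem_carrier \<open>c \<in> carrier G\<close>
  \<comment> \<open>Conjugation by \<open>c\<close> sends the \<open>m \<in> M\<close> with \<open>m a = b\<close> to another such element, so regularity of
    \<open>M\<close> puts \<open>m\<close> into the centraliser \<open>C\<close> of \<open>c\<close> in \<open>M\<close>. As \<open>M\<close> permutes the orbits of \<open>C\<close>, the
    group \<open>C\<close> is transitive, and \<open>c\<close> fixes every point because it fixes \<open>a\<close>.\<close>
  define C where "C = {m \<in> M. \<forall>w\<in>E. \<phi> c (\<phi> m w) = \<phi> m (\<phi> c w)}"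
  have C: "subgroup C G"
  proof (rule subgroupI)
    show "C \<subseteq> carrier G" "C \<noteq> {}"
      using M.subset M.one_closed by (auto simp: C_def rules one_action intro!: exI[of _ \<one>])
  next
    fix m assume m: "m \<in> C"
    have "\<phi> c (\<phi> (inv m) w) = \<phi> (inv m) (\<phi> c w)" if w: "w \<in> E" for w
    proof -
      have mM: "m \<in> M" and "\<And>w. w \<in> E \<Longrightarrow> \<phi> c (\<phi> m w) = \<phi> m (\<phi> c w)"
        using m by (auto simp: C_def)
      moreover have "\<phi> (inv m) w \<in> E"
        using mM w by (simp add: rules)
      ultimately have "\<phi> c (\<phi> m (\<phi> (inv m) w)) = \<phi> m (\<phi> c (\<phi> (inv m) w))"
        by blast
      then have "\<phi> (inv m) (\<phi> c w) = \<phi> (inv m) (\<phi> m (\<phi> c (\<phi> (inv m) w)))"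
        using mM w by (simp add: rules)
      also have "\<dots> = \<phi> c (\<phi> (inv m) w)"
        using mM w by (intro inv_action) (simp_all add: rules)
      finally show ?thesis by simp
    qed
    then show "inv m \<in> C" using m by (simp add: C_def)
  next
    fix m n assume "m \<in> C" "n \<in> C"
    then show "m \<otimes> n \<in> C" by (auto simp: C_def rules)
  qed
  obtain m where m: "m \<in> M" "\<phi> m a = b" using trans[OF \<open>a \<in> E\<close> \<open>b \<in> E\<close>] by blast
  have "m \<in> C"
  proof -
    let ?m = "c \<otimes> m \<otimes> inv c"
    have m': "?m \<in> M" using m M.inv_op_closed2 rules by blast
    have "\<phi> (inv c) a = a" using inv_action[of c a] assms by simp
    then have m'a: "\<phi> ?m a = \<phi> m a" using m assms by (simp add: rules)
    \<comment> \<open>\<open>?m\<close> and \<open>m\<close> agree at \<open>a\<close>. Both commute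
      on \<open>E\<close> with an \<open>n\<close> carrying \<open>a\<close> to
      \<open>\<phi> c w\<close>, so they agree there too; this is the regularity of
      \<open>M\<close>.\<close>
    have "\<phi> c (\<phi> m w) = \<phi> m (\<phi> c w)" if w: "w \<in> E" for w
    proof -
      have "\<phi> c w \<in> E" using w rules by blast
      then obtain n where n: "n \<in> M" "\<phi> n a = \<phi> c w" using trans[OF \<open>a \<in> E\<close>] by blast
      have "\<phi> c (\<phi> m w) = \<phi> ?m (\<phi> c w)" using w m by (simp add: rules)
      also have "\<dots> = \<phi> n (\<phi> ?m a)" using comm[OF m' n(1) \<open>a \<in> E\<close>] n(2) by simp
      also have "\<dots> = \<phi> m (\<phi> c w)" using comm[OF m(1) n(1) \<open>a \<in> E\<close>] n(2) m'a by simp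
      finally show ?thesis .
    qed
    then show ?thesis using m by (simp add: C_def)
  qed
  have "\<exists>n\<in>C. \<phi> n a = x"
  proof (rule transitive_subgroup_prime_degree[OF C assms(2) \<open>m \<in> C\<close> \<open>a \<in> E\<close> _ _ \<open>a \<in> E\<close> \<open>x \<in> E\<close>])
    show "\<phi> m a \<noteq> a" using m assms by simp
    fix x y assume "x \<in> E" "y \<in> E"
    then obtain n where n: "n \<in> M" "\<phi> n x = y" using trans by blast
    \<comment> \<open>\<open>C\<close> lies in \<open>M\<close>, whose elements act as commuting
      permutations, so \<open>k\<close> itself is the witness in both directions.\<close>
    moreover have "\<forall>k\<in>C. \<forall>w\<in>E. \<phi> n (\<phi> k w) = \<phi> k (\<phi> n w)"
      using comm n by (auto simp: C_def)
    ultimately show "\<exists>g\<in>carrier G. \<phi> g x = y \<and>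
        (\<forall>n\<in>C. \<exists>n'\<in>C. \<forall>w\<in>E. \<phi> g (\<phi> n w) = \<phi> n' (\<phi> g w)) \<and>
        (\<forall>n\<in>C. \<exists>n'\<in>C. \<forall>w\<in>E. \<phi> g (\<phi> n' w) = \<phi> n (\<phi> g w))"
      using M.mem_carrier by blast
  qed
  then obtain n where "n \<in> C" "\<phi> n a = x" by blast
  then show ?thesis using assms by (auto simp: C_def)
qed

text \<open>
  If \<open>c\<close> moved a point, then no term of the derived series would act trivially: each term is
  normal, and by the previous lemma it could not act as an abelian group.
\<close>

theorem (in transitive_action) solvable_prime_degree_fixed_points:
  assumes "solvable G" "prime (card E)"
    and "c \<in> carrier G" "a \<in> E" "b \<in> E" "a \<noteq> b" "\<phi> c a = a" "\<phi> c b = b" "x \<in> E"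
  shows "\<phi> c x = x"
proof (rule ccontr)
  assume moved: "\<phi> c x \<noteq> x"
  interpret group G by (rule group_G)
  have nontrivial: "(derived G ^^ n) (carrier G) \<lhd> G \<and>
      (\<exists>m\<in>(derived G ^^ n) (carrier G). \<exists>z\<in>E. \<phi> m z \<noteq> z)" for n
  proof (induction n)
    case 0
    then show ?case using moved assms normal_self by auto
  next
    case (Suc n)
    define M where "M = (derived G ^^ n) (carrier G)"
    have M: "M \<lhd> G" and "\<exists>m\<in>M. \<exists>z\<in>E. \<phi> m z \<noteq> z" using Suc by (simp_all add: M_def)
    then obtain m z where mz: "m \<in> M" "z \<in> E" "\<phi> m z \<noteq> z" by blast
    interpret M: normal M G by (rule M)
    have "\<exists>k\<in>derived G M. \<exists>z\<in>E. \<phi> k z \<noteq> z"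
    proof (rule ccontr)
      assume triv: "\<not> ?thesis"
      have "\<phi> m (\<phi> n y) = \<phi> n (\<phi> m y)" if mn: "m \<in> M" "n \<in> M" "y \<in> E" for m n y
      proof -
        \<comment> \<open>This commutator takes \<open>\<phi> n (\<phi> m y)\<close> to
          \<open>\<phi> m (\<phi> n y)\<close>; if it acts trivially, \<open>m\<close> and
          \<open>n\<close> commute at \<open>y\<close>.\<close>
        let ?k = "m \<otimes> n \<otimes> inv m \<otimes> inv n"
        have "?k \<in> derived G M"
          unfolding derived_def using mn by (intro generate.incl) blast
        moreover have "\<phi> n (\<phi> m y) \<in> E" using mn by (simp add: closed_action)
        ultimately have "\<phi> ?k (\<phi> n (\<phi> m y)) = \<phi> n (\<phi> m y)" using triv by blast
        moreover have "\<phi> ?k (\<phi> n (\<phi> m y)) = \<phi> m (\<phi> n y)"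
          using mn M.mem_carrier by (simp add: closed_action composition_rule inv_action)
        ultimately show ?thesis by simp
      qed
      then show False
        using abelian_normal_imp_fixed_point_free[OF M assms(2) mz _ assms(3-9)] moved by blast
    qed
    moreover have "derived G M \<lhd> G" using derived_is_normal M by blast
    ultimately show ?case by (simp add: M_def)
  qed
  obtain n where "(derived G ^^ n) (carrier G) = {\<one>}"
    using assms(1) solvable_iff_trivial_derived_seq by blast
  then show False using nontrivial[of n] one_action by auto
qed

section \<open>Inclusions between the graph types\<close>

lemma (in group) derived_eq_commutator_subgroup: "derived G H = commutator_subgroup G H H"
  by (simp add: derived_def commutator_subgroup_def)

text \<open>Replacing [H, H] by [H, G] only enlarges the set of generators.\<close>

lemma (in group) derived_subset_lower_central_series:
  "(derived G ^^ n) (carrier G) \<subseteq> lower_central_series G n"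
proof (induction n)
  case (Suc n)
  have "(derived G ^^ n) (carrier G) \<subseteq> carrier G" by (rule exp_of_derived_in_carrier) simp
  with Suc show ?case
    unfolding funpow.simps comp_def derived_def lower_central_series.simps commutator_subgroup_def
    by (intro mono_generate) blast
qed simp

lemma (in group) nilpotent_imp_solvable: "nilpotent_group G \<Longrightarrow> solvable G"
proof -
  assume "nilpotent_group G"
  then obtain n where "lower_central_series G n = {\<one>}" by (auto simp: nilpotent_group_def)
  moreover have "\<one> \<in> (derived G ^^ n) (carrier G)"
    using exp_of_derived_is_subgroup[OF subgroup_self] subgroup.one_closed by blast
  ultimately show ?thesis
    using derived_subset_lower_central_series[of n] solvable_iff_trivial_derived_seq by blast
qed

lemma (in comm_group) comm_group_imp_nilpotent: "nilpotent_group G"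
proof -
  have "lower_central_series G 1 = derived G (carrier G)"
    by (simp add: derived_eq_commutator_subgroup)
  then have "lower_central_series G 1 = {\<one>}"
    using derived_eq_singleton[of "carrier G"] by simp
  then show ?thesis unfolding nilpotent_group_def by blast
qed

text \<open>The centraliser of \<open>a\<close> is a subgroup, so it contains what \<open>S\<close>
  generates as soon as it contains \<open>S\<close>.\<close>

lemma (in group) commute_generate:
  assumes "S \<subseteq> carrier G" "a \<in> carrier G" "\<And>s. s \<in> S \<Longrightarrow> a \<otimes> s = s \<otimes> a" "x \<in> generate G S"
  shows "a \<otimes> x = x \<otimes> a"
  using assms(4)
proof induction
  case (inv s)
  then have "inv s \<otimes> (a \<otimes> s) \<otimes> inv s = inv s \<otimes> (s \<otimes> a) \<otimes> inv s"
    using assms(3) by simp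
  moreover have "s \<in> carrier G" using inv assms(1) by blast
  ultimately show ?case
    using assms(2) by (metis inv_closed inv_solve_left inv_solve_right m_assoc m_closed)
next
  case (eng x y)
  then have "x \<in> carrier G" "y \<in> carrier G" using assms(1) generate_in_carrier by blast+
  then show ?case using eng.IH assms(2) by (metis m_assoc)
qed (use assms in auto)

lemma (in group) comm_group_generate_pair:
  assumes "g \<in> carrier G" "h \<in> carrier G" "g \<otimes> h = h \<otimes> g"
  shows "comm_group (G\<lparr>carrier := generate G {g, h}\<rparr>)"
proof -
  let ?S = "{g, h}"
  have S: "?S \<subseteq> carrier G" using assms by simp
  have "s \<otimes> t = t \<otimes> s" if "s \<in> ?S" "t \<in> ?S" for s t
    using that assms(3) by (metis insertE singletonD)
  then have "s \<otimes> x = x \<otimes> s" if "s \<in> ?S" "x \<in> generate G ?S" for s x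
    using that commute_generate[OF S] S by blast
  \<comment> \<open>Second use of the centraliser argument: \<open>x\<close> is now known to commute
    with both generators, hence with all of the subgroup.\<close>
  then have "x \<otimes> y = y \<otimes> x" if "x \<in> generate G ?S" "y \<in> generate G ?S" for x y
    using that commute_generate[OF S, of x y] generate_in_carrier[OF S] by metis
  moreover have "group (G\<lparr>carrier := generate G ?S\<rparr>)"
    by (rule subgroup_imp_group[OF generate_is_subgroup[OF S]])
  ultimately show ?thesis by (intro group.group_comm_groupI) auto
qed

text \<open>Powers of one element commute, a commuting pair generates an abelian and hence nilpotent
  group, and nilpotent groups are solvable. The four relations thus form a chain with the two named
  ones at its ends.\<close>

lemma (in group) joined_mono:
  assumes "g \<in> carrier G" "h \<in> carrier G"
  shows "joined Enhanced_Power G g h \<Longrightarrow> joined A G g h"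
    and "joined A G g h \<Longrightarrow> joined Solvable G g h"
proof -
  let ?K = "G\<lparr>carrier := generate G {g, h}\<rparr>"
  have "group ?K" using assms by (simp add: generate_is_subgroup subgroup_imp_group)
  then have ns: "joined Nilpotent G g h \<Longrightarrow> joined Solvable G g h"
    using group.nilpotent_imp_solvable by auto
  have ec: "joined Enhanced_Power G g h \<Longrightarrow> joined Commuting G g h"
    by (auto simp: int_pow_mult[symmetric] add.commute)
  have cn: "joined Commuting G g h \<Longrightarrow> joined Nilpotent G g h"
    using comm_group_generate_pair[OF assms] comm_group.comm_group_imp_nilpotent by auto
  show "joined Enhanced_Power G g h \<Longrightarrow> joined A G g h"
    using ns ec cn by (cases A) blast+
  show "joined A G g h \<Longrightarrow> joined Solvable G g h"
    using ns ec cn by (cases A) blast+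
qed

section \<open>Realising finite graphs\<close>

text \<open>For \<open>r \<le> q\<close> this is the cycle (0 1 ... r-1) in the symmetric group on
  \<open>{..<q}\<close>. The restriction is there because \<open>Bij\<close> contains only
  extensional functions.\<close>

definition cyc :: "nat \<Rightarrow> nat \<Rightarrow> nat \<Rightarrow> nat" where
  "cyc r q = (\<lambda>i\<in>{..<q}. if i < r then Suc i mod r else i)"

lemma cyc_Bij: "r \<le> q \<Longrightarrow> cyc r q \<in> Bij {..<q}"
proof -
  assume "r \<le> q"
  then have "cyc r q ` {..<q} \<subseteq> {..<q}"
    by (auto simp: cyc_def intro: less_le_trans[OF mod_less_divisor])
  moreover have "inj_on (cyc r q) {..<q}"
    by (rule inj_onI) (auto simp: cyc_def mod_Suc split: if_splits)
  ultimately show ?thesis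
    using endo_inj_surj[of "{..<q}" "cyc r q"] by (simp add: Bij_def bij_betw_def) (simp add: cyc_def)
qed

lemma cyc_funpow: "r \<le> q \<Longrightarrow> i < r \<Longrightarrow> (cyc r q ^^ n) i = (i + n) mod r"
proof (induction n)
  case (Suc n)
  then have "(i + n) mod r < r" "(i + n) mod r < q"
    by (auto intro: less_le_trans[OF mod_less_divisor])
  then have "cyc r q ((i + n) mod r) = Suc ((i + n) mod r) mod r"
    using Suc.prems by (simp add: cyc_def)
  then show ?case using Suc by (simp add: mod_Suc_eq)
qed simp

lemma cyc_funpow_fixed: "r \<le> i \<Longrightarrow> i < q \<Longrightarrow> (cyc r q ^^ n) i = i"
proof -
  assume "r \<le> i" "i < q"
  then have "cyc r q i = i" by (simp add: cyc_def)
  then show ?thesis by (induction n) simp_all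
qed

lemma cyc_transitive:
  assumes "x < q" "y < q"
  shows "\<exists>n. (cyc q q ^^ n) x = y"
proof
  \<comment> \<open>The summand \<open>q\<close> keeps the exponent correct for
    \<open>y < x\<close>, where \<open>y - x\<close> would be truncated.\<close>
  show "(cyc q q ^^ (q - x + y)) x = y"
    using assms by (simp add: cyc_funpow)
qed

section \<open>Restricted actions, powers and conjugates\<close>

lemma group_action_BijGroup: "group_action (BijGroup E) E (\<lambda>f. f)"
proof -
  have "(\<lambda>f. f) \<in> hom (BijGroup E) (BijGroup E)" by (rule homI) (rule refl | assumption)+
  then show ?thesis
    by (simp add: group_action_def group_hom_def group_hom_axioms_def group_BijGroup)
qed

lemma (in group_action) group_action_comp:
  assumes "group H" "h \<in> hom H G"
  shows "group_action H E (\<lambda>x. \<phi> (h x))"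
proof -
  have "\<phi> \<in> hom G (BijGroup E)" using group_hom by (simp add: group_hom_def group_hom_axioms_def)
  then have "\<phi> \<circ> h \<in> hom H (BijGroup E)" using assms(2) by (rule hom_compose[rotated])
  then show ?thesis
    using assms(1) by (simp add: group_action_def group_hom_def group_hom_axioms_def group_BijGroup comp_def)
qed

lemma (in group_action) group_action_subgroup:
  assumes "subgroup K G"
  shows "group_action (G\<lparr>carrier := K\<rparr>) E \<phi>"
proof -
  interpret group G by (rule group_G)
  show ?thesis
    using group_action_comp[of "G\<lparr>carrier := K\<rparr>" "\<lambda>x. x"] assms subgroup_imp_group subgroup.subset
    by (fastforce simp: hom_def)
qed

lemma (in group_action) pow_action:
  assumes "g \<in> carrier G" "x \<in> E"
  shows "\<phi> (g [^] (n::nat)) x = (\<phi> g ^^ n) x"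
  using assms(2)
proof (induction n arbitrary: x)
  case 0
  then show ?case by (simp add: one_action)
next
  case (Suc n)
  interpret group G by (rule group_G)
  show ?case
    using Suc assms(1) by (simp add: composition_rule closed_action funpow_swap1)
qed

text \<open>Evaluated at \<open>\<phi> h x\<close>, the factor \<open>inv h\<close> cancels. In this
  form \<open>h\<close> visibly transports fixed points, moved points and orbits of \<open>g\<close>
  to those of its conjugate.\<close>

lemma (in group_action) conj_action:
  assumes "g \<in> carrier G" "h \<in> carrier G" "x \<in> E"
  shows "\<phi> (h \<otimes> g \<otimes> inv h) (\<phi> h x) = \<phi> h (\<phi> g x)"
proof -
  interpret group G by (rule group_G)
  show ?thesis using assms by (simp add: composition_rule closed_action inv_action)
qed

lemma (in group_action) conj_action_funpow:
  assumes "g \<in> carrier G" "h \<in> carrier G" "x \<in> E"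
  shows "(\<phi> (h \<otimes> g \<otimes> inv h) ^^ n) (\<phi> h x) = \<phi> h ((\<phi> g ^^ n) x)"
proof (induction n)
  case (Suc n)
  have "(\<phi> g ^^ n) x \<in> E"
    by (induction n) (use assms closed_action in auto)
  then show ?case using Suc assms conj_action by simp
qed simp

lemma conj_classE:
  assumes "y \<in> conj_class G x" "x \<in> carrier G"
  obtains h where "h \<in> carrier G" "y = h \<otimes>\<^bsub>G\<^esub> x \<otimes>\<^bsub>G\<^esub> inv\<^bsub>G\<^esub> h"
proof -
  obtain h where "h \<in> carrier G" "y = conjugation G h x"
    using assms(1) unfolding Group_Action.orbit_def by blast
  then show thesis
    using assms(2) that by (simp add: conjugation_def)
qed

text \<open>The iterates of \<open>t'\<close> are already transitive, as those of \<open>t\<close>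
  are, so the generated group is transitive of prime degree. The conjugate \<open>c'\<close> fixes
  the translates of \<open>a\<close> and \<open>b\<close> but moves that of \<open>z\<close>,
  against the theorem of Galois. The two conjugating elements may differ.\<close>

lemma (in group_action) not_solvable_conj:
  assumes "prime (card E)" "c \<in> carrier G" "t \<in> carrier G"
    and trans: "\<And>x y. x \<in> E \<Longrightarrow> y \<in> E \<Longrightarrow> \<exists>n. (\<phi> t ^^ n) x = y"
    and c: "a \<in> E" "b \<in> E" "a \<noteq> b" "\<phi> c a = a" "\<phi> c b = b" "z \<in> E" "\<phi> c z \<noteq> z"
    and "c' \<in> conj_class G c" "t' \<in> conj_class G t"
  shows "\<not> joined Solvable G c' t'"
proof
  assume sol: "joined Solvable G c' t'"
  interpret group G by (rule group_G)
  obtain h where h: "h \<in> carrier G" "c' = h \<otimes> c \<otimes> inv h"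
    using assms by (blast elim: conj_classE)
  obtain k where k: "k \<in> carrier G" "t' = k \<otimes> t \<otimes> inv k"
    using assms by (blast elim: conj_classE)
  define K where "K = generate G {c', t'}"
  have K: "subgroup K G"
    using h k assms by (auto simp: K_def intro: generate_is_subgroup)
  have cK: "c' \<in> K" and tK: "t' \<in> K" by (auto simp: K_def intro: generate.incl)
  interpret K: group_action "G\<lparr>carrier := K\<rparr>" E \<phi> using K by (rule group_action_subgroup)
  interpret K: transitive_action "G\<lparr>carrier := K\<rparr>" E \<phi>
  proof
    fix x y assume xy: "x \<in> E" "y \<in> E"
    \<comment> \<open>Points are pulled back by \<open>k\<close>, connected there by a power of
      \<open>t\<close>, and pushed forward again.\<close>
    have "\<phi> (inv k) x \<in> E" "\<phi> (inv k) y \<in> E" using xy k closed_action by simp_all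
    then obtain n where "(\<phi> t ^^ n) (\<phi> (inv k) x) = \<phi> (inv k) y" using trans by blast
    then have "(\<phi> t' ^^ n) x = y"
      using conj_action_funpow[OF assms(3) k(1) \<open>\<phi> (inv k) x \<in> E\<close>, of n] k xy action_inv by simp
    moreover have "\<phi> (t' [^]\<^bsub>G\<lparr>carrier := K\<rparr>\<^esub> n) x = (\<phi> t' ^^ n) x"
      using tK xy by (intro K.pow_action) simp_all
    moreover have "t' [^]\<^bsub>G\<lparr>carrier := K\<rparr>\<^esub> n \<in> K"
      using monoid.nat_pow_closed[OF group.is_monoid[OF K.group_G]] tK by fastforce
    ultimately show "\<exists>g\<in>carrier (G\<lparr>carrier := K\<rparr>). \<phi> g x = y" by auto
  qed
  have "\<phi> c' (\<phi> h z) = \<phi> h z"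
  proof (rule K.solvable_prime_degree_fixed_points)
    show "solvable (G\<lparr>carrier := K\<rparr>)" using sol by (simp add: K_def)
    show "\<phi> h a \<noteq> \<phi> h b" using inj_prop[OF h(1)] c by (meson inj_onD)
  qed (use assms h cK in \<open>auto simp: closed_action conj_action\<close>)
  then have "\<phi> h (\<phi> c z) = \<phi> h z" using h assms by (simp add: conj_action)
  then have "\<phi> c z = z" using inj_prop[OF h(1)] c closed_action assms(2) by (meson inj_onD)
  then show False using c by simp
qed

text \<open>With am + bn = 1, the power of gh with exponent bn is the same power of g, since h to
  the n is trivial; and that is g, since g to the am is trivial. By symmetry h is a power of gh as
  well.\<close>

lemma (in group) coprime_joined_Enhanced_Power:
  assumes "g \<in> carrier G" "h \<in> carrier G" "g \<otimes> h = h \<otimes> g"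
    and "g [^] (m::nat) = \<one>" "h [^] (n::nat) = \<one>" "coprime m n"
  shows "joined Enhanced_Power G g h"
proof -
  have power: "\<exists>i::int. g = (g \<otimes> h) [^] i"
    if gh: "g \<in> carrier G" "h \<in> carrier G" "g \<otimes> h = h \<otimes> g"
      "g [^] m = \<one>" "h [^] n = \<one>" "coprime m n" for g h and m n :: nat
  proof -
    obtain a b where ab: "a * int m + b * int n = 1"
      using bezout_int[of "int m" "int n"] gh(6) by auto
    have "h [^] (b * int n) = \<one>"
      using int_pow_pow[of h "int n" b] gh by (simp add: int_pow_int mult.commute)
    moreover have "g [^] (a * int m) = \<one>"
      using int_pow_pow[of g "int m" a] gh by (simp add: int_pow_int mult.commute)
    moreover have "g = g [^] (a * int m) \<otimes> g [^] (b * int n)"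
      using gh ab by (simp add: int_pow_mult[symmetric])
    ultimately have "g = (g \<otimes> h) [^] (b * int n)"
      using gh int_pow_mult_distrib[of g h] by simp
    then show ?thesis by blast
  qed
  have "\<exists>i::int. g = (g \<otimes> h) [^] i" using assms by (intro power)
  moreover have "\<exists>i::int. h = (g \<otimes> h) [^] i"
    using power[of h g n m] assms by (simp add: coprime_commute)
  ultimately show ?thesis using assms by auto
qed

section \<open>Products of symmetric groups, carried on natural numbers\<close>

lemma finite_group_nat_copy:
  assumes "group G" "finite (carrier G)"
  shows "\<exists>H :: nat monoid. \<exists>h. group H \<and> finite (carrier H) \<and> h \<in> iso H G"
proof -
  interpret group G by fact
  obtain f where f: "bij_betw f (carrier G) {..<card (carrier G)}"
    using ex_bij_betw_finite_nat[OF assms(2)] by (auto simp: atLeast0LessThan)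
  \<comment> \<open>The operation is transported along \<open>f\<close>, because
    \<open>finite_groups\<close> contains only groups on natural numbers.\<close>
  define H where "H = \<lparr>carrier = {..<card (carrier G)},
    monoid.mult = (\<lambda>x y. f (inv_into (carrier G) f x \<otimes>\<^bsub>G\<^esub> inv_into (carrier G) f y)), one = f \<one>\<^bsub>G\<^esub>\<rparr>"
  have iso: "f \<in> iso G H"
    using f by (auto simp: iso_def hom_def H_def bij_betw_def)
  have "H\<lparr>one := f \<one>\<^bsub>G\<^esub>\<rparr> = H" by (simp add: H_def)
  then have "group H" using iso_imp_img_group[OF iso] by simp
  moreover have "finite (carrier H)" by (simp add: H_def)
  ultimately show ?thesis using iso_set_sym[OF iso] by blast
qed

text \<open>The three properties of the actions are all that is used of the product later: it acts
  on every \<open>E e\<close>, permutations of the factors can be prescribed independently, and an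
  element is determined by its actions. They hide both the product and its copy on the natural
  numbers.\<close>

lemma product_permutation_group:
  assumes "finite I" "\<And>e. e \<in> I \<Longrightarrow> finite (E e)"
  obtains G :: "nat monoid" and \<phi> where "group G" "finite (carrier G)"
    "\<And>e. e \<in> I \<Longrightarrow> group_action G (E e) (\<phi> e)"
    "\<And>f. (\<And>e. e \<in> I \<Longrightarrow> f e \<in> Bij (E e)) \<Longrightarrow> \<exists>g\<in>carrier G. \<forall>e\<in>I. \<phi> e g = f e"
    "\<And>x y. x \<in> carrier G \<Longrightarrow> y \<in> carrier G \<Longrightarrow>
      (\<And>e i. e \<in> I \<Longrightarrow> i \<in> E e \<Longrightarrow> \<phi> e x i = \<phi> e y i) \<Longrightarrow> x = y"
proof -
  define P where "P = product_group I (\<lambda>e. BijGroup (E e))"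
  have "group P" unfolding P_def by (simp add: group_BijGroup)
  have carr: "carrier P = (\<Pi>\<^sub>E e\<in>I. Bij (E e))" by (simp add: P_def BijGroup_def)
  have "finite (Bij (E e))" if "e \<in> I" for e
  proof (rule finite_subset)
    show "Bij (E e) \<subseteq> (\<Pi>\<^sub>E i\<in>E e. E e)"
      unfolding PiE_def using Bij_imp_extensional Bij_imp_funcset by blast
    show "finite (\<Pi>\<^sub>E i\<in>E e. E e)" using assms(2) that by (intro finite_PiE) auto
  qed
  then have "finite (carrier P)" using assms(1) by (simp add: carr finite_PiE)
  then obtain H :: "nat monoid" and h where H: "group H" "finite (carrier H)" and h: "h \<in> iso H P"
    using finite_group_nat_copy \<open>group P\<close> by blast
  have hom: "h \<in> hom H P" and bij: "bij_betw h (carrier H) (carrier P)"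
    using h by (auto simp: iso_def)
  show thesis
  proof (rule that[of H "\<lambda>e x. h x e"])
    fix e assume e: "e \<in> I"
    have "(\<lambda>f. f e) \<in> hom P (BijGroup (E e))"
      using e by (auto simp: hom_def P_def)
    then have "group_action P (E e) (\<lambda>f. f e)"
      by (rule group_action.group_action_comp[OF group_action_BijGroup \<open>group P\<close>])
    then show "group_action H (E e) (\<lambda>x. h x e)"
      using group_action.group_action_comp H(1) hom by blast
  next
    fix f assume f: "\<And>e. e \<in> I \<Longrightarrow> f e \<in> Bij (E e)"
    then have "restrict f I \<in> carrier P" by (simp add: carr)
    then obtain g where "g \<in> carrier H" "h g = restrict f I"
      using bij unfolding bij_betw_def by (metis imageE)
    then show "\<exists>g\<in>carrier H. \<forall>e\<in>I. h g e = f e" by (intro bexI[of _ g]) simp_all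
  next
    fix x y assume xy: "x \<in> carrier H" "y \<in> carrier H"
      and eq: "\<And>e i. e \<in> I \<Longrightarrow> i \<in> E e \<Longrightarrow> h x e i = h y e i"
    have hx: "h x \<in> (\<Pi>\<^sub>E e\<in>I. Bij (E e))" and hy: "h y \<in> (\<Pi>\<^sub>E e\<in>I. Bij (E e))"
      using bij xy carr by (auto simp: bij_betw_def)
    have "h x e = h y e" if "e \<in> I" for e
    \<comment> \<open>Components are extensional on \<open>E e\<close>, so agreement on
      \<open>E e\<close> makes them equal.\<close>
    proof (rule extensionalityI[of _ "E e"])
      show "h x e \<in> extensional (E e)" "h y e \<in> extensional (E e)"
        using hx hy that by (auto intro!: Bij_imp_extensional)
    qed (use eq that in auto)
    then have "h x = h y" by (rule PiE_ext[OF hx hy])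
    then show "x = y" using bij xy unfolding bij_betw_def by (meson inj_onD)
  qed (use H in auto)
qed

lemma ex_odd_primes:
  assumes "finite V"
  shows "\<exists>p :: 'a \<Rightarrow> nat. inj_on p V \<and> (\<forall>v. prime (p v) \<and> odd (p v))"
proof -
  let ?P = "{p :: nat. prime p \<and> odd p}"
  have "infinite ?P"
  proof
    assume "finite ?P"
    then have "finite (insert 2 ?P)" by simp
    moreover have "{p :: nat. prime p} \<subseteq> insert 2 ?P"
      using primes_dvd_imp_eq[of 2 "_ :: nat"] by auto
    ultimately show False using primes_infinite finite_subset by blast
  qed
  then obtain Q where Q: "Q \<subseteq> ?P" "finite Q" "card Q = card V"
    using infinite_arbitrarily_large by blast
  then obtain f where f: "bij_betw f V Q" using assms finite_same_card_bij by metis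
  \<comment> \<open>The default 3 makes \<open>p v\<close> an odd prime for every \<open>v\<close>,
    which saves membership conditions; injectivity is claimed on \<open>V\<close> only.\<close>
  define p where "p = (\<lambda>v. if v \<in> V then f v else 3)"
  have "prime (3 :: nat)" by simp
  then have "prime (p v) \<and> odd (p v)" for v
    using f Q(1) by (auto simp: p_def bij_betw_def)
  moreover have "inj_on p V"
    using f by (auto simp: p_def bij_betw_def inj_on_def)
  ultimately show ?thesis by blast
qed

text \<open>No graph type occurs here: arcs get the strongest relation, at the chosen elements, and
  non-arcs are denied the weakest, for all conjugates.\<close>

lemma realisation:
  assumes "pair_graph \<Gamma>"
  obtains G :: "nat monoid" and g where "group G" "finite (carrier G)"
    "\<And>v. g v \<in> carrier G"
    "\<And>u v. (u, v) \<in> parcs \<Gamma> \<Longrightarrow> joined Enhanced_Power G (g u) (g v)"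
    "\<And>u v x y. u \<in> pverts \<Gamma> \<Longrightarrow> v \<in> pverts \<Gamma> \<Longrightarrow> u \<noteq> v \<Longrightarrow> (u, v) \<notin> parcs \<Gamma> \<Longrightarrow>
      x \<in> conj_class G (g u) \<Longrightarrow> y \<in> conj_class G (g v) \<Longrightarrow> \<not> joined Solvable G x y"
    "\<And>u v. u \<in> pverts \<Gamma> \<Longrightarrow> v \<in> pverts \<Gamma> \<Longrightarrow> u \<noteq> v \<Longrightarrow> g v \<notin> conj_class G (g u)"
proof -
  interpret pair_graph \<Gamma> by fact
  define V where "V = pverts \<Gamma>"
  obtain p :: "'a \<Rightarrow> nat" where p: "inj_on p V" "\<And>v. prime (p v)" "\<And>v. odd (p v)"
    using ex_odd_primes[of V] by (auto simp: V_def)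
  \<comment> \<open>The graph has no loops, so all diagonal pairs over \<open>V\<close> belong to
    \<open>I\<close>.\<close>
  define I where "I = {(u, v). u \<in> V \<and> v \<in> V \<and> (u, v) \<notin> parcs \<Gamma>}"
  define q where "q e = max (p (fst e)) (p (snd e))" for e
  define ends where "ends e = {fst e, snd e}" for e :: "'a \<times> 'a"
  have "I \<subseteq> V \<times> V" by (auto simp: I_def)
  then have "finite I" by (rule finite_subset) (simp add: V_def)
  then obtain G :: "nat monoid" and \<phi> where G: "group G" "finite (carrier G)"
    and act: "\<And>e. e \<in> I \<Longrightarrow> group_action G {..<q e} (\<phi> e)"
    and lift: "\<And>f. (\<And>e. e \<in> I \<Longrightarrow> f e \<in> Bij {..<q e}) \<Longrightarrow> \<exists>g\<in>carrier G. \<forall>e\<in>I. \<phi> e g = f e"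
    and ext: "\<And>x y. x \<in> carrier G \<Longrightarrow> y \<in> carrier G \<Longrightarrow>
      (\<And>e i. e \<in> I \<Longrightarrow> i \<in> {..<q e} \<Longrightarrow> \<phi> e x i = \<phi> e y i) \<Longrightarrow> x = y"
    using product_permutation_group[of I "\<lambda>e. {..<q e}"] by blast
  interpret group G by fact
  have pq: "v \<in> ends e \<Longrightarrow> p v \<le> q e" for v e by (auto simp: ends_def q_def)
  have "\<exists>x\<in>carrier G. \<forall>e\<in>I. \<phi> e x = (if v \<in> ends e then cyc (p v) (q e) else (\<lambda>i\<in>{..<q e}. i))" for v
    by (rule lift) (auto simp: id_Bij cyc_Bij pq)
  then obtain g where gG: "\<And>v. g v \<in> carrier G"
    and g: "\<And>v e. e \<in> I \<Longrightarrow> \<phi> e (g v) = (if v \<in> ends e then cyc (p v) (q e) else (\<lambda>i\<in>{..<q e}. i))"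
    by metis
  have p_gt: "p v > 2" for v
    using p(2,3)[of v] prime_ge_2_nat[of "p v"] by (cases "p v = 2") auto
  \<comment> \<open>The point 0 serves throughout as a point that every nontrivial component
    moves.\<close>
  have move: "cyc (p v) (q e) 0 \<noteq> 0" "0 < q e" if "v \<in> ends e" for v e
    using pq[OF that] p_gt[of v] by (simp_all add: cyc_def)
  show thesis
  proof (rule that[of G g])
    fix u v assume uv: "(u, v) \<in> parcs \<Gamma>"
    then have "u \<noteq> v" "u \<in> V" "v \<in> V" using no_loops' in_arcsD1 in_arcsD2 by (auto simp: V_def)
    then have "p u \<noteq> p v" using p(1) by (auto dest: inj_onD)
    have vu: "(v, u) \<in> parcs \<Gamma>" using uv arcs_symmetric by auto
    show "joined Enhanced_Power G (g u) (g v)"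
    proof (rule coprime_joined_Enhanced_Power[OF gG gG])
      show "g u \<otimes>\<^bsub>G\<^esub> g v = g v \<otimes>\<^bsub>G\<^esub> g u"
      proof (rule ext)
        fix e i assume ei: "e \<in> I" "i \<in> {..<q e}"
        interpret group_action G "{..<q e}" "\<phi> e" using act ei by blast
        \<comment> \<open>Otherwise \<open>e\<close> would be \<open>(u, v)\<close> or
          \<open>(v, u)\<close>, both of which are arcs. Hence in each factor one of the two
          elements acts as the identity.\<close>
        have "u \<notin> ends e \<or> v \<notin> ends e"
          using ei uv vu \<open>u \<noteq> v\<close> by (auto simp: I_def ends_def)
        moreover have "\<phi> e (g u) i \<in> {..<q e}" "\<phi> e (g v) i \<in> {..<q e}"
          using ei gG closed_action by blast+
        ultimately show "\<phi> e (g u \<otimes>\<^bsub>G\<^esub> g v) i = \<phi> e (g v \<otimes>\<^bsub>G\<^esub> g u) i"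
          using ei by (auto simp: composition_rule gG g)
      qed (simp_all add: gG)
      \<comment> \<open>In every factor \<open>g w\<close> is the identity or a cycle of length
        \<open>p w\<close>; points from \<open>p w\<close> on are fixed.\<close>
      have "g w [^]\<^bsub>G\<^esub> p w = \<one>\<^bsub>G\<^esub>" for w
      proof (rule ext)
        fix e i assume ei: "e \<in> I" "i \<in> {..<q e}"
        interpret group_action G "{..<q e}" "\<phi> e" using act ei by blast
        have "((\<lambda>i\<in>{..<q e}. i) ^^ n) i = i" for n
          using ei by (induction n) auto
        moreover have "w \<in> ends e \<Longrightarrow> (cyc (p w) (q e) ^^ p w) i = i"
          using ei pq[of w e] by (cases "i < p w") (simp_all add: cyc_funpow cyc_funpow_fixed)
        ultimately show "\<phi> e (g w [^]\<^bsub>G\<^esub> p w) i = \<phi> e \<one>\<^bsub>G\<^esub> i"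
          using ei by (simp add: pow_action gG one_action g)
      qed (simp_all add: gG)
      then show "g u [^]\<^bsub>G\<^esub> p u = \<one>\<^bsub>G\<^esub>" "g v [^]\<^bsub>G\<^esub> p v = \<one>\<^bsub>G\<^esub>" by blast+
      show "coprime (p u) (p v)" using p(2) \<open>p u \<noteq> p v\<close> by (intro primes_coprime)
    qed
  next
    \<comment> \<open>Only the set of ends of \<open>e\<close> matters, so the one factor
      \<open>(u, v)\<close> serves whichever of the two primes is smaller.\<close>
    have main: "\<not> joined Solvable G x y"
      if less: "p u < p v" and e: "e \<in> I" "ends e = {u, v}"
        and xy: "x \<in> conj_class G (g u)" "y \<in> conj_class G (g v)" for u v x y e
    proof -
      interpret group_action G "{..<q e}" "\<phi> e" using act e by blast
      have qe: "q e = p v" using less e(2) by (auto simp: q_def ends_def doubleton_eq_iff)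
      \<comment> \<open>Two odd numbers are not consecutive, so the shorter cycle fixes both
        \<open>p u\<close> and \<open>Suc (p u)\<close>; this is where oddness matters.\<close>
      have "p v \<noteq> Suc (p u)" using p(3)[of u] p(3)[of v] by auto
      then have gap: "Suc (p u) < p v" using less by simp
      have gu: "\<phi> e (g u) = cyc (p u) (p v)" and gv: "\<phi> e (g v) = cyc (p v) (p v)"
        using e by (simp_all add: g qe)
      show ?thesis
      proof (rule not_solvable_conj[OF _ gG gG _ _ _ _ _ _ _ _ xy])
        show "prime (card {..<q e})" using p(2) by (simp add: qe)
        show "\<And>x y. x \<in> {..<q e} \<Longrightarrow> y \<in> {..<q e} \<Longrightarrow> \<exists>n. (\<phi> e (g v) ^^ n) x = y"
          by (simp add: qe gv cyc_transitive)
        show "p u \<in> {..<q e}" "Suc (p u) \<in> {..<q e}" "p u \<noteq> Suc (p u)" "0 \<in> {..<q e}"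
          using gap by (simp_all add: qe)
        show "\<phi> e (g u) (p u) = p u" "\<phi> e (g u) (Suc (p u)) = Suc (p u)"
          using gap by (simp_all add: gu cyc_def)
        show "\<phi> e (g u) 0 \<noteq> 0" using move[of u e] e by (simp add: gu qe)
      qed
    qed
    fix u v x y
    assume uv: "u \<in> pverts \<Gamma>" "v \<in> pverts \<Gamma>" "u \<noteq> v" "(u, v) \<notin> parcs \<Gamma>"
      and xy: "x \<in> conj_class G (g u)" "y \<in> conj_class G (g v)"
    then have I: "(u, v) \<in> I" by (simp add: I_def V_def)
    have "p u \<noteq> p v" using uv p(1) by (auto simp: V_def dest: inj_onD)
    then consider "p u < p v" | "p v < p u" by linarith
    then show "\<not> joined Solvable G x y"
    proof cases
      case 1
      then show ?thesis using main[OF _ I _ xy] by (simp add: ends_def)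
    next
      case 2
      then have "\<not> joined Solvable G y x" using main[OF _ I _ xy(2,1)] by (simp add: ends_def insert_commute)
      then show ?thesis using joined_sym[of Solvable G x y] by blast
    qed
  next
    fix u v assume uv: "u \<in> pverts \<Gamma>" "v \<in> pverts \<Gamma>" "u \<noteq> v"
    show "g v \<notin> conj_class G (g u)"
    proof
      assume "g v \<in> conj_class G (g u)"
      then obtain h where h: "h \<in> carrier G" "g v = h \<otimes>\<^bsub>G\<^esub> g u \<otimes>\<^bsub>G\<^esub> inv\<^bsub>G\<^esub> h"
        using gG by (blast elim: conj_classE)
      \<comment> \<open>In this factor \<open>g v\<close> acts trivially while \<open>g u\<close>
        moves 0, and conjugation cannot turn a nontrivial permutation into the identity.\<close>
      define e where "e = (u, u)"
      have e: "e \<in> I" using uv no_loops' by (auto simp: I_def V_def e_def)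
      interpret group_action G "{..<q e}" "\<phi> e" using act e by blast
      have ue: "u \<in> ends e" "v \<notin> ends e" using uv by (auto simp: e_def ends_def)
      have 0: "0 \<in> {..<q e}" using move(2)[OF ue(1)] by simp
      then have "\<phi> e (g v) (\<phi> e h 0) = \<phi> e h (\<phi> e (g u) 0)"
        using conj_action[OF gG h(1)] h(2) by simp
      moreover have "\<phi> e (g v) (\<phi> e h 0) = \<phi> e h 0"
        using ue e closed_action[OF h(1) 0] by (simp add: g)
      ultimately have "\<phi> e (g u) 0 = 0"
        using inj_prop[OF h(1)] 0 closed_action[OF gG 0] by (metis inj_onD)
      then show False using move(1)[OF ue(1)] e ue by (simp add: g)
    qed
  qed (use G gG in auto)
qed

section \<open>From arc-reflecting injections to universality\<close>

lemma universalI: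
  fixes \<C> :: "'a pair_pre_digraph set"
  assumes "\<And>\<Delta>. \<Delta> \<in> \<C> \<Longrightarrow> pair_graph \<Delta>"
    and emb: "\<And>\<Gamma> :: 'v pair_pre_digraph. pair_graph \<Gamma> \<Longrightarrow>
      \<exists>\<Delta>\<in>\<C>. \<exists>f. inj_on f (pverts \<Gamma>) \<and> f ` pverts \<Gamma> \<subseteq> pverts \<Delta> \<and>
        (\<forall>u\<in>pverts \<Gamma>. \<forall>v\<in>pverts \<Gamma>. (u, v) \<in> parcs \<Gamma> \<longleftrightarrow> (f u, f v) \<in> parcs \<Delta>)"
  shows "universal TYPE('v) \<C>"
  unfolding universal_def
proof (intro conjI ballI allI impI)
  fix \<Gamma> :: "'v pair_pre_digraph" assume \<Gamma>: "pair_graph \<Gamma>"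
  interpret G: pair_graph \<Gamma> by fact
  obtain \<Delta> f where \<Delta>: "\<Delta> \<in> \<C>" and f: "inj_on f (pverts \<Gamma>)" "f ` pverts \<Gamma> \<subseteq> pverts \<Delta>"
      and arc_iff: "\<forall>u\<in>pverts \<Gamma>. \<forall>v\<in>pverts \<Gamma>. (u, v) \<in> parcs \<Gamma> \<longleftrightarrow> (f u, f v) \<in> parcs \<Delta>"
    using emb[OF \<Gamma>] by metis
  interpret D: pair_graph \<Delta> using \<Delta> assms(1) by blast
  \<comment> \<open>\<open>S\<close> is the image of \<Gamma>, which makes the isomorphism
    immediate; that it is induced in \<Delta> comes from \<open>f\<close> reflecting arcs.\<close>
  define S where "S = \<lparr>pverts = f ` pverts \<Gamma>, parcs = map_prod f f ` parcs \<Gamma>\<rparr>"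
  have arcs: "e \<in> parcs \<Gamma> \<Longrightarrow> fst e \<in> pverts \<Gamma> \<and> snd e \<in> pverts \<Gamma>" for e
    using G.arc_fst_in_verts G.arc_snd_in_verts by blast
  have S_arcs: "parcs S = {e \<in> parcs \<Delta>. fst e \<in> pverts S \<and> snd e \<in> pverts S}"
  proof
    show "parcs S \<subseteq> {e \<in> parcs \<Delta>. fst e \<in> pverts S \<and> snd e \<in> pverts S}"
    proof
      fix e assume "e \<in> parcs S"
      then obtain u v where "(u, v) \<in> parcs \<Gamma>" "e = (f u, f v)" by (auto simp: S_def)
      then show "e \<in> {e \<in> parcs \<Delta>. fst e \<in> pverts S \<and> snd e \<in> pverts S}"
        using arcs[of "(u, v)"] arc_iff by (simp add: S_def)
    qed
    show "{e \<in> parcs \<Delta>. fst e \<in> pverts S \<and> snd e \<in> pverts S} \<subseteq> parcs S"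
    proof
      fix e assume e: "e \<in> {e \<in> parcs \<Delta>. fst e \<in> pverts S \<and> snd e \<in> pverts S}"
      then obtain u v where uv: "u \<in> pverts \<Gamma>" "v \<in> pverts \<Gamma>" "e = (f u, f v)"
        by (cases e) (auto simp: S_def)
      then have "(u, v) \<in> parcs \<Gamma>" using e arc_iff by simp
      then have "map_prod f f (u, v) \<in> map_prod f f ` parcs \<Gamma>" by (rule imageI)
      then show "e \<in> parcs S" using uv by (simp add: S_def)
    qed
  qed
  have "wf_digraph (with_proj S)"
    using G.in_arcsD1 G.in_arcsD2 by unfold_locales (auto simp: S_def)
  then have "subgraph (with_proj S) (with_proj \<Delta>)"
    using f(2) S_arcs D.wf_digraph by (auto simp: subgraph_def S_def)
  then have ind: "induced_subgraph (with_proj S) (with_proj \<Delta>)"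
    using S_arcs by (simp add: induced_subgraph_def)
  define F where "F = \<lparr>iso_verts = f, iso_arcs = map_prod f f, iso_head = snd, iso_tail = fst\<rparr>"
  have "inj_on (map_prod f f) (parcs \<Gamma>)"
    by (rule inj_on_subset[OF map_prod_inj_on[OF f(1) f(1)]]) (use arcs in force)
  then have "pre_digraph.digraph_isomorphism (with_proj \<Gamma>) F"
    using f(1) G.wf_digraph by (auto simp: pre_digraph.digraph_isomorphism_def F_def)
  moreover have "with_proj S = app_iso F (with_proj \<Gamma>)"
    by (simp add: app_iso_def F_def S_def with_proj_def)
  ultimately have "digraph_iso (with_proj \<Gamma>) (with_proj S)"
    unfolding digraph_iso_def by blast
  then show "\<exists>\<Delta>\<in>\<C>. \<exists>S :: 'a pair_pre_digraph. induced_subgraph (with_proj S) (with_proj \<Delta>) \<and>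
      digraph_iso (with_proj \<Gamma>) (with_proj S)"
    using \<Delta> ind by blast
qed (use assms(1) in blast)

section \<open>Universality of the uncompressed and compressed super graphs\<close>

theorem theorem2p2:
  fixes A :: graph_type
  shows "universal TYPE('v) (conj_super_graph A ` finite_groups) \<and>
         universal TYPE('v) (compressed_conj_super_graph A ` finite_groups)"
proof
  \<comment> \<open>One characterisation of the arcs serves both graphs: adjacency of some
    conjugates is the condition in the compressed graph and the second alternative in the
    uncompressed one.\<close>
  have realise: "\<exists>G\<in>finite_groups. \<exists>g. (\<forall>v. g v \<in> carrier G) \<and>
      (\<forall>u\<in>pverts \<Gamma>. \<forall>v\<in>pverts \<Gamma>. u \<noteq> v \<longrightarrow> g v \<notin> conj_class G (g u)) \<and>
      (\<forall>u\<in>pverts \<Gamma>. \<forall>v\<in>pverts \<Gamma>. (u, v) \<in> parcs \<Gamma> \<longleftrightarrow> u \<noteq> v \<and>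
        (\<exists>x\<in>conj_class G (g u). \<exists>y\<in>conj_class G (g v). (x, y) \<in> parcs (group_graph A G)))"
    if \<Gamma>: "pair_graph \<Gamma>" for \<Gamma> :: "'v pair_pre_digraph"
  proof -
    interpret pair_graph \<Gamma> by fact
    obtain G :: "nat monoid" and g where G: "group G" "finite (carrier G)" and g: "\<And>v. g v \<in> carrier G"
      and edge: "\<And>u v. (u, v) \<in> parcs \<Gamma> \<Longrightarrow> joined Enhanced_Power G (g u) (g v)"
      and non_edge: "\<And>u v x y. u \<in> pverts \<Gamma> \<Longrightarrow> v \<in> pverts \<Gamma> \<Longrightarrow> u \<noteq> v \<Longrightarrow> (u, v) \<notin> parcs \<Gamma> \<Longrightarrow>
        x \<in> conj_class G (g u) \<Longrightarrow> y \<in> conj_class G (g v) \<Longrightarrow> \<not> joined Solvable G x y"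
      and classes: "\<And>u v. u \<in> pverts \<Gamma> \<Longrightarrow> v \<in> pverts \<Gamma> \<Longrightarrow> u \<noteq> v \<Longrightarrow> g v \<notin> conj_class G (g u)"
      using realisation[OF \<Gamma>] by blast
    interpret group G by fact
    interpret conj: group_action G "carrier G" "conjugation G"
      by (rule group_action_conjugation) fact
    have refl: "g v \<in> conj_class G (g v)" for v using conj.orbit_refl g by blast
    have "(u, v) \<in> parcs \<Gamma> \<longleftrightarrow> u \<noteq> v \<and>
        (\<exists>x\<in>conj_class G (g u). \<exists>y\<in>conj_class G (g v). (x, y) \<in> parcs (group_graph A G))"
      if uv: "u \<in> pverts \<Gamma>" "v \<in> pverts \<Gamma>" for u v
    proof
      assume arc: "(u, v) \<in> parcs \<Gamma>"
      then have "u \<noteq> v" using no_loops' by auto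
      \<comment> \<open>Distinctness is part of adjacency in \<open>group_graph\<close>, which
        \<open>joined\<close> alone does not give.\<close>
      then have "g u \<noteq> g v" using classes[OF uv] refl[of u] by auto
      then have "(g u, g v) \<in> parcs (group_graph A G)"
        using g joined_mono(1)[OF g g] edge[OF arc] by (simp add: group_graph_def)
      then show "u \<noteq> v \<and>
          (\<exists>x\<in>conj_class G (g u). \<exists>y\<in>conj_class G (g v). (x, y) \<in> parcs (group_graph A G))"
        using refl \<open>u \<noteq> v\<close> by blast
    next
      assume "u \<noteq> v \<and>
          (\<exists>x\<in>conj_class G (g u). \<exists>y\<in>conj_class G (g v). (x, y) \<in> parcs (group_graph A G))"
      then obtain x y where "u \<noteq> v" and xy: "x \<in> conj_class G (g u)" "y \<in> conj_class G (g v)"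
          "x \<in> carrier G" "y \<in> carrier G" "joined A G x y"
        by (auto simp: group_graph_def)
      then show "(u, v) \<in> parcs \<Gamma>"
        using non_edge[OF uv _ _ xy(1,2)] joined_mono(2)[OF xy(3,4,5)] by blast
    qed
    moreover have "G \<in> finite_groups" using G by (simp add: finite_groups_def)
    ultimately show ?thesis using g classes by blast
  qed
  show "universal TYPE('v) (conj_super_graph A ` finite_groups)"
  proof (rule universalI)
    show "pair_graph \<Delta>" if "\<Delta> \<in> conj_super_graph A ` finite_groups" for \<Delta> :: "nat pair_pre_digraph"
      using that pair_graph_conj_super_graph by (auto simp: finite_groups_def)
    fix \<Gamma> :: "'v pair_pre_digraph" assume "pair_graph \<Gamma>"
    then obtain G :: "nat monoid" and g where G: "G \<in> finite_groups" and g: "\<And>v. g v \<in> carrier G"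
      and classes: "\<And>u v. u \<in> pverts \<Gamma> \<Longrightarrow> v \<in> pverts \<Gamma> \<Longrightarrow> u \<noteq> v \<Longrightarrow> g v \<notin> conj_class G (g u)"
      and arcs: "\<And>u v. u \<in> pverts \<Gamma> \<Longrightarrow> v \<in> pverts \<Gamma> \<Longrightarrow> (u, v) \<in> parcs \<Gamma> \<longleftrightarrow> u \<noteq> v \<and>
        (\<exists>x\<in>conj_class G (g u). \<exists>y\<in>conj_class G (g v). (x, y) \<in> parcs (group_graph A G))"
      using realise by metis
    interpret conj: group_action G "carrier G" "conjugation G"
      using G by (intro group_action_conjugation) (simp add: finite_groups_def)
    have "inj_on g (pverts \<Gamma>)"
      by (rule inj_onI) (metis classes conj.orbit_refl[OF g])
    \<comment> \<open>The alternative that the two elements are conjugate is excluded by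
      \<open>classes\<close>.\<close>
    then have "(u, v) \<in> parcs \<Gamma> \<longleftrightarrow> (g u, g v) \<in> parcs (conj_super_graph A G)"
      if "u \<in> pverts \<Gamma>" "v \<in> pverts \<Gamma>" for u v
      using arcs[OF that] classes[OF that] g that
      by (auto simp: conj_super_graph_def dest: inj_onD)
    moreover have "g ` pverts \<Gamma> \<subseteq> pverts (conj_super_graph A G)"
      using g by (auto simp: conj_super_graph_def)
    ultimately show "\<exists>\<Delta>\<in>conj_super_graph A ` finite_groups. \<exists>f. inj_on f (pverts \<Gamma>) \<and>
        f ` pverts \<Gamma> \<subseteq> pverts \<Delta> \<and>
        (\<forall>u\<in>pverts \<Gamma>. \<forall>v\<in>pverts \<Gamma>. (u, v) \<in> parcs \<Gamma> \<longleftrightarrow> (f u, f v) \<in> parcs \<Delta>)"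
      using G \<open>inj_on g (pverts \<Gamma>)\<close> by blast
  qed
  show "universal TYPE('v) (compressed_conj_super_graph A ` finite_groups)"
  proof (rule universalI)
    show "pair_graph \<Delta>" if "\<Delta> \<in> compressed_conj_super_graph A ` finite_groups"
      for \<Delta> :: "nat set pair_pre_digraph"
      using that pair_graph_compressed_conj_super_graph by (auto simp: finite_groups_def)
    fix \<Gamma> :: "'v pair_pre_digraph" assume "pair_graph \<Gamma>"
    then obtain G :: "nat monoid" and g where G: "G \<in> finite_groups" and g: "\<And>v. g v \<in> carrier G"
      and classes: "\<And>u v. u \<in> pverts \<Gamma> \<Longrightarrow> v \<in> pverts \<Gamma> \<Longrightarrow> u \<noteq> v \<Longrightarrow> g v \<notin> conj_class G (g u)"
      and arcs: "\<And>u v. u \<in> pverts \<Gamma> \<Longrightarrow> v \<in> pverts \<Gamma> \<Longrightarrow> (u, v) \<in> parcs \<Gamma> \<longleftrightarrow> u \<noteq> v \<and>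
        (\<exists>x\<in>conj_class G (g u). \<exists>y\<in>conj_class G (g v). (x, y) \<in> parcs (group_graph A G))"
      using realise by metis
    interpret conj: group_action G "carrier G" "conjugation G"
      using G by (intro group_action_conjugation) (simp add: finite_groups_def)
    let ?f = "\<lambda>v. conj_class G (g v)"
    \<comment> \<open>\<open>g v\<close> lies in its own class, so equal classes would put it in
      that of \<open>g u\<close>.\<close>
    have inj: "inj_on ?f (pverts \<Gamma>)"
      by (rule inj_onI) (metis classes conj.orbit_refl[OF g])
    have classes_in: "?f v \<in> conj_classes G" for v using g by (auto simp: orbits_def)
    have "(u, v) \<in> parcs \<Gamma> \<longleftrightarrow> (?f u, ?f v) \<in> parcs (compressed_conj_super_graph A G)"
      if "u \<in> pverts \<Gamma>" "v \<in> pverts \<Gamma>" for u v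
      using arcs[OF that] inj_on_eq_iff[OF inj that] classes_in
      by (auto simp: compressed_conj_super_graph_def)
    moreover have "?f ` pverts \<Gamma> \<subseteq> pverts (compressed_conj_super_graph A G)"
      using classes_in by (auto simp: compressed_conj_super_graph_def)
    ultimately show "\<exists>\<Delta>\<in>compressed_conj_super_graph A ` finite_groups. \<exists>f. inj_on f (pverts \<Gamma>) \<and>
        f ` pverts \<Gamma> \<subseteq> pverts \<Delta> \<and>
        (\<forall>u\<in>pverts \<Gamma>. \<forall>v\<in>pverts \<Gamma>. (u, v) \<in> parcs \<Gamma> \<longleftrightarrow> (f u, f v) \<in> parcs \<Delta>)"
      using G inj by blast
  qed
qed

end
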